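(* Consider the spaces $c$, $c_0$ and $c_{00}$ over $\mathbb{K}$ with the supremum norm. (1) For each $\mathbb{X}\in\{c,c_0,c_{00}\}$, the left-symmetric points of $\mathbb{X}$ are exactly the elements $ce_n$ with $n\in\mathbb{N}$ and $c\in\mathbb{K}$. (2) The right-symmetric points of $c$ are exactly the sequences $x=(x_n)_{n\in\mathbb{N}}\in c$ such that $|x_n|=\|x\|$ for every $n\in\mathbb{N}$; the spaces $c_0$ and $c_{00}$ have no non-zero right-symmetric point. (3) For each $\mathbb{X}\in\{c,c_0,c_{00}\}$, the linear isometries of $\mathbb{X}$ onto itself are exactly the (restrictions to $\mathbb{X}$ of) signed permutation operators on $\mathbb{K}^{\mathbb{N}}$ that map $\mathbb{X}$ onto $\mathbb{X}$.
   Context: $\mathbb{K}$ is $\mathbb{R}$ or $\mathbb{C}$. $c$, $c_0$ and $c_{00}$ are the spaces of convergent, convergent-to-zero and eventually zero sequences in $\mathbb{K}$ respectively, with the supremum norm $\|\cdot\|$. In a normed space $\mathbb{X}$ over $\mathbb{K}$, $x\perp_B y$ means $\|x+\lambda y\|\ge\|x\|$ for all $\lambda\in\mathbb{K}$. A point $x\in\mathbb{X}$ is left-symmetric (resp. right-symmetric) if for every $y\in\mathbb{X}$, $x\perp_B y\Rightarrow y\perp_B x$ (resp. $y\perp_B x\Rightarrow x\perp_B y$). $e_n$ is the sequence whose $n$-th term is $1$ and whose other terms are $0$. A map $S:\mathbb{K}^{\mathbb{N}}\to\mathbb{K}^{\mathbb{N}}$ is a signed permutation operator if there exist a bijection $\sigma:\mathbb{N}\to\mathbb{N}$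 and scalars $c_n\in\mathbb{K}$ with $|c_n|=1$ for all $n$ such that $S(x)=(c_nx_{\sigma(n)})_{n\in\mathbb{N}}$ for all $x=(x_n)_{n\in\mathbb{N}}\in\mathbb{K}^{\mathbb{N}}$. *)

theory Defs
  imports Complex_Main
begin

text \<open>
  Sequences over the scalar field are functions \<open>nat \<Rightarrow> 'k\<close>. The definitions are polymorphic in
  \<open>'k\<close>; the scalar fields of interest are \<^typ>\<open>real\<close> and \<^typ>\<open>complex\<close>. The spaces are subsets of
  this function type with the pointwise vector space operations.
\<close>

definition conv_seqs :: "(nat \<Rightarrow> 'k::real_normed_field) set" where
  "conv_seqs = {x. convergent x}"

definition null_seqs :: "(nat \<Rightarrow> 'k::real_normed_field) set" where
  "null_seqs = {x. x \<longlonglongrightarrow> 0}"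

definition fin_seqs :: "(nat \<Rightarrow> 'k::real_normed_field) set" where
  "fin_seqs = {x. \<forall>\<^sub>F n in sequentially. x n = 0}"

text \<open>Only meaningful for bounded sequences, hence on all three spaces above.\<close>

definition sup_norm :: "(nat \<Rightarrow> 'k::real_normed_field) \<Rightarrow> real" where
  "sup_norm x = (SUP n. norm (x n))"

definition unit_seq :: "nat \<Rightarrow> nat \<Rightarrow> 'k::real_normed_field" where
  "unit_seq n = (\<lambda>k. if k = n then 1 else 0)"

text \<open>Birkhoff--James orthogonality; the scalar ranges over the whole field \<open>'k\<close>.\<close>

definition bj_orth :: "(nat \<Rightarrow> 'k::real_normed_field) \<Rightarrow> (nat \<Rightarrow> 'k) \<Rightarrow> bool" where
  "bj_orth x y \<longleftrightarrow> (\<forall>l::'k. sup_norm (\<lambda>n. x n + l * y n) \<ge> sup_norm x)"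

definition left_symmetric :: "(nat \<Rightarrow> 'k::real_normed_field) set \<Rightarrow> (nat \<Rightarrow> 'k) \<Rightarrow> bool" where
  "left_symmetric X x \<longleftrightarrow> x \<in> X \<and> (\<forall>y\<in>X. bj_orth x y \<longrightarrow> bj_orth y x)"

definition right_symmetric :: "(nat \<Rightarrow> 'k::real_normed_field) set \<Rightarrow> (nat \<Rightarrow> 'k) \<Rightarrow> bool" where
  "right_symmetric X x \<longleftrightarrow> x \<in> X \<and> (\<forall>y\<in>X. bj_orth y x \<longrightarrow> bj_orth x y)"

text \<open>The values of \<open>T\<close> outside \<open>X\<close> are irrelevant: \<open>T\<close> stands for its restriction to \<open>X\<close>.\<close>

definition linear_isometry_onto ::
    "(nat \<Rightarrow> 'k::real_normed_field) set \<Rightarrow> ((nat \<Rightarrow> 'k) \<Rightarrow> (nat \<Rightarrow> 'k)) \<Rightarrow> bool" where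
  "linear_isometry_onto X T \<longleftrightarrow>
     T ` X = X \<and>
     (\<forall>x\<in>X. \<forall>y\<in>X. T (\<lambda>n. x n + y n) = (\<lambda>n. T x n + T y n)) \<and>
     (\<forall>a. \<forall>x\<in>X. T (\<lambda>n. a * x n) = (\<lambda>n. a * T x n)) \<and>
     (\<forall>x\<in>X. sup_norm (T x) = sup_norm x)"

definition signed_permutation :: "((nat \<Rightarrow> 'k::real_normed_field) \<Rightarrow> (nat \<Rightarrow> 'k)) \<Rightarrow> bool" where
  "signed_permutation S \<longleftrightarrow>
     (\<exists>(\<sigma>::nat \<Rightarrow> nat) (c::nat \<Rightarrow> 'k). bij \<sigma> \<and> (\<forall>n. norm (c n) = 1) \<and>
        (\<forall>x. S x = (\<lambda>n. c n * x (\<sigma> n))))"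

end

theory Submission
  imports Defs "HOL-Analysis.Inner_Product"
begin

text \<open>
  Everything rests on Birkhoff--James orthogonality to a unit sequence being a condition on a single
  coordinate: a non-zero multiple of \<open>e\<^sub>n\<close> is orthogonal to \<open>y\<close> exactly when \<open>y n = 0\<close>
  (\<open>bj_orth_unit_seq_iff\<close>). The argument for left symmetry and for isometries is the same for all
  three spaces, since it only uses that they consist of bounded sequences and are subspaces
  containing every \<open>e\<^sub>n\<close>; the locale \<open>sequence_space\<close> records this.

  Left symmetry: if \<open>e\<^sub>n\<close> is orthogonal to \<open>y\<close> then adding multiples of \<open>e\<^sub>n\<close> to \<open>y\<close> leaves all
  non-zero coordinates of \<open>y\<close> alone, so \<open>y\<close> is orthogonal to \<open>e\<^sub>n\<close>. Conversely, if \<open>x\<close> has two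
  non-zero coordinates, let \<open>n\<close> be the one of smaller modulus. The coordinate \<open>n\<close> does not matter
  for the norm of \<open>x\<close>, hence \<open>x\<close> is orthogonal to \<open>e\<^sub>n\<close>, while \<open>e\<^sub>n\<close> is not orthogonal to \<open>x\<close>.

  Right symmetry: if some coordinate satisfies \<open>norm (x n) < sup_norm x\<close>, replace \<open>x n\<close> by a scalar
  of modulus \<open>sup_norm x\<close> pointing in the opposite direction. The new sequence \<open>y\<close> is orthogonal to
  \<open>x\<close>, because adding a multiple of \<open>x\<close> cannot shorten both the coordinate \<open>n\<close> and the others; but
  moving from \<open>x\<close> a little towards \<open>-y\<close> shortens the other coordinates and lengthens only the
  coordinate \<open>n\<close>, which was short (\<open>right_symmetric_norm_eq\<close>). A non-zero null sequence always has such a coordinate. If on the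
  other hand all coordinates of \<open>x\<close> have the same modulus, dividing by \<open>x\<close> coordinatewise reduces
  the question to the constant sequence \<open>1\<close>, where a uniform estimate in the scalar field
  (\<open>norm_add_of_real_le\<close>) settles it (\<open>bj_orth_constant_modulus\<close>).

  Isometries: a linear isometry onto the space preserves orthogonality in both directions, hence
  permutes the left-symmetric points, so \<open>T e\<^sub>n = c\<^sub>n e\<^bsub>s n\<^esub>\<close> with \<open>s\<close> a bijection. As
  \<open>x - x\<^sub>n e\<^sub>n\<close> vanishes at \<open>n\<close>, the unit sequence \<open>e\<^sub>n\<close> is orthogonal to it; applying \<open>T\<close> shows that
  \<open>T x - x\<^sub>n c\<^sub>n e\<^bsub>s n\<^esub>\<close> vanishes at \<open>s n\<close>. This determines every coordinate of
  \<open>T x\<close> without density of the finite sequences, which fails in the space of convergent sequences.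
\<close>

section \<open>The supremum norm and orthogonality\<close>

lemma norm_le_sup_norm:
  assumes "Bseq x"
  shows "norm (x n) \<le> sup_norm x"
proof -
  obtain K where "\<forall>n. norm (x n) \<le> K"
    using assms by (auto simp: Bseq_def)
  then have "bdd_above (range (\<lambda>n. norm (x n)))"
    by (auto intro: bdd_aboveI)
  then show ?thesis
    unfolding sup_norm_def by (rule cSUP_upper2[where x = n]) auto
qed

lemma sup_norm_le:
  assumes "\<And>n. norm (x n) \<le> M"
  shows "sup_norm x \<le> M"
  unfolding sup_norm_def by (rule cSUP_least) (auto simp: assms)

lemma Bseq_add_scaled:
  fixes x y :: "nat \<Rightarrow> 'k::real_normed_field"
  assumes "Bseq x" "Bseq y"
  shows "Bseq (\<lambda>n. x n + l * y n)"
proof -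
  obtain K L where K: "\<And>n. norm (x n) \<le> K" and L: "\<And>n. norm (y n) \<le> L"
    using assms by (auto simp: Bseq_def)
  have "norm (x n + l * y n) \<le> K + norm l * L" for n
    by (intro norm_triangle_le add_mono K) (simp add: norm_mult L mult_left_mono)
  then show ?thesis
    by (rule BseqI')
qed

lemma Bseq_unit_seq: "Bseq (unit_seq n)"
  by (rule BseqI'[where K = 1]) (simp add: unit_seq_def)

lemma bj_orthI:
  assumes "\<And>l n. norm (x n) \<le> sup_norm (\<lambda>n. x n + l * y n)"
  shows "bj_orth x y"
  unfolding bj_orth_def by (auto intro: sup_norm_le assms)

lemma not_bj_orthI:
  assumes "\<And>n. norm (x n + l * y n) \<le> M" "M < sup_norm x"
  shows "\<not> bj_orth x y"
  unfolding bj_orth_def using sup_norm_le[of "\<lambda>n. x n + l * y n", OF assms(1)] assms(2)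
  by (meson not_le le_less_trans)

lemma sup_norm_scaled_unit_seq:
  "sup_norm (\<lambda>k. c * unit_seq n k) = norm (c :: 'k::real_normed_field)"
proof (rule antisym)
  show "sup_norm (\<lambda>k. c * unit_seq n k) \<le> norm c"
    by (rule sup_norm_le) (simp add: unit_seq_def)
  have "Bseq (\<lambda>k. c * unit_seq n k)"
    by (rule BseqI'[where K = "norm c"]) (simp add: unit_seq_def)
  from norm_le_sup_norm[OF this, of n] show "norm c \<le> sup_norm (\<lambda>k. c * unit_seq n k)"
    by (simp add: unit_seq_def)
qed

text \<open>
  If \<open>y n \<noteq> 0\<close>, a small multiple of \<open>y\<close> cancels part of the only non-zero coordinate of the unit
  sequence, and by boundedness of \<open>y\<close> the other coordinates remain small.
\<close>

lemma bj_orth_unit_seq_iff: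
  fixes c :: "'k::real_normed_field"
  assumes "Bseq y" "c \<noteq> 0"
  shows "bj_orth (\<lambda>k. c * unit_seq n k) y \<longleftrightarrow> y n = 0"
proof
  assume 0: "y n = 0"
  show "bj_orth (\<lambda>k. c * unit_seq n k) y"
  proof (rule bj_orthI)
    fix l k
    have "Bseq (\<lambda>k. c * unit_seq n k + l * y k)"
      by (intro Bseq_add_scaled assms BseqI'[where K = "norm c"]) (simp add: unit_seq_def)
    from norm_le_sup_norm[OF this, of n]
    have "norm c \<le> sup_norm (\<lambda>k. c * unit_seq n k + l * y k)"
      using 0 by (simp add: unit_seq_def)
    moreover have "norm (c * unit_seq n k) \<le> norm c"
      by (simp add: unit_seq_def)
    ultimately show "norm (c * unit_seq n k) \<le> sup_norm (\<lambda>k. c * unit_seq n k + l * y k)"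
      by linarith
  qed
next
  assume orth: "bj_orth (\<lambda>k. c * unit_seq n k) y"
  show "y n = 0"
  proof (rule ccontr)
    assume nz: "y n \<noteq> 0"
    define M where "M = sup_norm y"
    have M: "norm (y k) \<le> M" for k
      unfolding M_def by (rule norm_le_sup_norm[OF assms(1)])
    have M0: "0 < M"
      using M[of n] nz by (meson less_le_trans zero_less_norm_iff)
    define t where "t = norm (y n) / (2 * M)"
    have t: "0 < t" "t \<le> 1 / 2"
      using M0 M[of n] nz by (auto simp: t_def field_simps)
    define l where "l = - of_real t * c / y n"
    have "norm (c * unit_seq n k + l * y k) \<le> norm c * (1 - t)" for k
    proof (cases "k = n")
      case True
      have "c * unit_seq n k + l * y k = c * of_real (1 - t)"
        using nz True by (simp add: l_def unit_seq_def algebra_simps)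
      then show ?thesis
        using t by (simp add: norm_mult del: of_real_diff)
    next
      case False
      have "norm (c * unit_seq n k + l * y k) = norm c * (t * norm (y k) / norm (y n))"
        using False t by (simp add: unit_seq_def l_def norm_mult norm_divide)
      also have "t * norm (y k) / norm (y n) = norm (y k) / (2 * M)"
        using nz by (simp add: t_def)
      also have "\<dots> \<le> 1 / 2"
        using M[of k] M0 by (simp add: field_simps)
      also have "\<dots> \<le> 1 - t"
        using t by simp
      finally show ?thesis
        by (simp add: mult_left_mono)
    qed
    then have "\<not> bj_orth (\<lambda>k. c * unit_seq n k) y"
      by (rule not_bj_orthI) (use t assms in \<open>simp add: sup_norm_scaled_unit_seq\<close>)
    then show False
      using orth by blast
  qed
qed

lemma bj_orth_unit_seq:
  assumes "Bseq y"
  shows "bj_orth (unit_seq n) y \<longleftrightarrow> y n = 0"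
  using bj_orth_unit_seq_iff[OF assms, of 1 n] by simp

section \<open>The three spaces\<close>

locale sequence_space =
  fixes X :: "(nat \<Rightarrow> 'k::real_normed_field) set"
  assumes bounded: "x \<in> X \<Longrightarrow> Bseq x"
    and add_closed: "x \<in> X \<Longrightarrow> y \<in> X \<Longrightarrow> (\<lambda>n. x n + y n) \<in> X"
    and scale_closed: "x \<in> X \<Longrightarrow> (\<lambda>n. a * x n) \<in> X"
    and unit_seq_closed: "unit_seq n \<in> X"
begin

lemma add_scaled_closed: "x \<in> X \<Longrightarrow> y \<in> X \<Longrightarrow> (\<lambda>n. x n + l * y n) \<in> X"
  by (intro add_closed scale_closed)

lemma fun_upd_closed:
  assumes "x \<in> X"
  shows "x(n := v) \<in> X"
proof -
  have "x(n := v) = (\<lambda>k. x k + (v - x n) * unit_seq n k)"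
    by (auto simp: unit_seq_def)
  then show ?thesis
    using add_scaled_closed[OF assms unit_seq_closed] by simp
qed

end

lemma unit_seq_eventually_0: "\<forall>\<^sub>F k in sequentially. unit_seq n k = 0"
  using eventually_gt_at_top[of n] by eventually_elim (simp add: unit_seq_def)

lemma fin_seqs_subset_null_seqs: "fin_seqs \<subseteq> null_seqs"
  by (auto simp: fin_seqs_def null_seqs_def intro: tendsto_eventually)

lemma null_seqs_subset_conv_seqs: "null_seqs \<subseteq> conv_seqs"
  by (auto simp: conv_seqs_def null_seqs_def convergent_def)

lemma Bseq_conv_seqs: "x \<in> conv_seqs \<Longrightarrow> Bseq x"
  by (simp add: conv_seqs_def convergent_imp_Bseq)

lemma unit_seq_fin_seqs: "unit_seq n \<in> fin_seqs"
  by (simp add: fin_seqs_def unit_seq_eventually_0)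

lemma sequence_space_conv_seqs: "sequence_space conv_seqs"
proof
  show "unit_seq n \<in> conv_seqs" for n
    using unit_seq_fin_seqs fin_seqs_subset_null_seqs null_seqs_subset_conv_seqs by blast
qed (auto simp: Bseq_conv_seqs conv_seqs_def intro: convergent_add convergent_mult convergent_const)

lemma sequence_space_null_seqs: "sequence_space null_seqs"
proof
  show "unit_seq n \<in> null_seqs" for n
    using unit_seq_fin_seqs fin_seqs_subset_null_seqs by blast
  show "x \<in> null_seqs \<Longrightarrow> Bseq x" for x :: "nat \<Rightarrow> 'a"
    using Bseq_conv_seqs null_seqs_subset_conv_seqs by blast
qed (auto simp: null_seqs_def intro: tendsto_add_zero tendsto_mult_right_zero)

lemma sequence_space_fin_seqs: "sequence_space fin_seqs"
proof
  show "x \<in> fin_seqs \<Longrightarrow> Bseq x" for x :: "nat \<Rightarrow> 'a"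
    using Bseq_conv_seqs null_seqs_subset_conv_seqs fin_seqs_subset_null_seqs by blast
  show "(\<lambda>n. x n + y n) \<in> fin_seqs" if "x \<in> fin_seqs" "y \<in> fin_seqs" for x y :: "nat \<Rightarrow> 'a"
    using that unfolding fin_seqs_def mem_Collect_eq by eventually_elim simp
qed (auto simp: fin_seqs_def unit_seq_eventually_0 elim: eventually_mono)

section \<open>Left-symmetric points\<close>

context sequence_space
begin

lemma left_symmetric_scaled_unit_seq: "left_symmetric X (\<lambda>k. a * unit_seq n k)"
proof -
  have "bj_orth y (\<lambda>k. a * unit_seq n k)"
    if y: "y \<in> X" and orth: "bj_orth (\<lambda>k. a * unit_seq n k) y" for y
  proof (cases "a = 0")
    case True
    then show ?thesis by (simp add: bj_orth_def)
  next
    case False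
    then have y0: "y n = 0"
      using orth bj_orth_unit_seq_iff bounded y by blast
    show ?thesis
    proof (rule bj_orthI)
      fix l k
      have "Bseq (\<lambda>k. y k + l * (a * unit_seq n k))"
        by (intro bounded add_scaled_closed scale_closed unit_seq_closed y)
      from norm_le_sup_norm[OF this, of k] norm_le_sup_norm[OF this, of n]
      show "norm (y k) \<le> sup_norm (\<lambda>k. y k + l * (a * unit_seq n k))"
        using y0 by (cases "k = n") (auto simp: unit_seq_def intro: order_trans[OF norm_ge_zero])
    qed
  qed
  then show ?thesis
    by (simp add: left_symmetric_def scale_closed unit_seq_closed)
qed

text \<open>The coordinate \<open>m\<close> bounds the coordinate \<open>n\<close>, so changing the latter cannot lower the norm.\<close>

lemma bj_orth_unit_seq_right:
  assumes "x \<in> X" "n \<noteq> m" "norm (x n) \<le> norm (x m)"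
  shows "bj_orth x (unit_seq n)"
proof (rule bj_orthI)
  fix l k
  have "Bseq (\<lambda>k. x k + l * unit_seq n k)"
    by (intro bounded add_scaled_closed unit_seq_closed assms)
  from norm_le_sup_norm[OF this, of k] norm_le_sup_norm[OF this, of m]
  show "norm (x k) \<le> sup_norm (\<lambda>k. x k + l * unit_seq n k)"
    using assms by (cases "k = n") (auto simp: unit_seq_def)
qed

lemma left_symmetric_unique_coordinate:
  assumes "left_symmetric X x" "x n \<noteq> 0" "x m \<noteq> 0"
  shows "n = m"
proof (rule ccontr)
  assume "n \<noteq> m"
  have x: "x \<in> X"
    using assms(1) by (simp add: left_symmetric_def)
  have *: False if "x i \<noteq> 0" "i \<noteq> j" "norm (x i) \<le> norm (x j)" for i j
  proof -
    have "bj_orth (unit_seq i) x"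
      using assms(1) bj_orth_unit_seq_right[OF x that(2,3)] unit_seq_closed
      by (auto simp: left_symmetric_def)
    then show False
      using bj_orth_unit_seq[OF bounded[OF x]] that by blast
  qed
  show False
    using *[of n m] *[of m n] assms \<open>n \<noteq> m\<close> by linarith
qed

lemma left_symmetric_iff: "left_symmetric X x \<longleftrightarrow> (\<exists>a n. x = (\<lambda>k. a * unit_seq n k))"
proof
  assume l: "left_symmetric X x"
  show "\<exists>a n. x = (\<lambda>k. a * unit_seq n k)"
  proof (cases "\<exists>n. x n \<noteq> 0")
    case True
    then obtain n where n: "x n \<noteq> 0" by blast
    have "x k = x n * unit_seq n k" for k
      using left_symmetric_unique_coordinate[OF l n, of k] by (auto simp: unit_seq_def)
    then have "x = (\<lambda>k. x n * unit_seq n k)" ..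
    then show ?thesis by blast
  next
    case False
    then have "x = (\<lambda>k. 0 * unit_seq 0 k)" by auto
    then show ?thesis by blast
  qed
qed (auto simp: left_symmetric_scaled_unit_seq)

end

section \<open>Right-symmetric points\<close>

text \<open>
  The witness against right symmetry is \<open>x\<close> with its short coordinate \<open>n\<close> replaced by one that has
  full length \<open>sup_norm x\<close> and points away from \<open>x n\<close>.
\<close>

lemma (in sequence_space) right_symmetric_norm_eq:
  assumes rs: "right_symmetric X x"
  shows "norm (x n) = sup_norm x"
proof (rule ccontr)
  assume ne: "norm (x n) \<noteq> sup_norm x"
  have x: "x \<in> X"
    using rs by (simp add: right_symmetric_def)
  define R where "R = sup_norm x"
  define a where "a = norm (x n)"
  have R: "norm (x k) \<le> R" for k
    unfolding R_def by (rule norm_le_sup_norm[OF bounded[OF x]])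
  have aR: "a < R" and a0: "0 \<le> a"
    using ne R[of n] by (auto simp: R_def a_def)
  define u where "u = (if x n = 0 then 1 else x n / of_real a)"
  have u: "norm u = 1" "x n = of_real a * u"
    by (auto simp: u_def a_def norm_divide)
  define y where "y = x(n := - of_real R * u)"
  have y: "y \<in> X"
    unfolding y_def by (rule fun_upd_closed[OF x])
  have yR: "norm (y k) \<le> R" for k
    using R[of k] aR a0 u by (simp add: y_def norm_mult)
  have "bj_orth y x"
  proof (rule bj_orthI)
    fix l k
    define N where "N = sup_norm (\<lambda>k. y k + l * x k)"
    have N: "norm (y k + l * x k) \<le> N" for k
      unfolding N_def by (rule norm_le_sup_norm[OF bounded[OF add_scaled_closed[OF y x]]])
    have "R \<le> N"
    proof (rule ccontr)
      assume "\<not> R \<le> N"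
      then have less: "max N a < R"
        using aR by simp
      then obtain j where j: "max N a < norm (x j)"
        using sup_norm_le[of x "max N a"] unfolding R_def by (meson not_le)
      then have "j \<noteq> n"
        by (auto simp: a_def)
      then have "y j + l * x j = (1 + l) * x j"
        by (simp add: y_def algebra_simps)
      then have "norm (1 + l) * norm (x j) \<le> N"
        using N[of j] by (simp add: norm_mult)
      then have l1: "norm (1 + l) < 1"
        using j mult_right_mono[of 1 "norm (1 + l)" "norm (x j)"] by fastforce
      have "y n + l * x n = - (of_real R - of_real a * l) * u"
        by (simp add: y_def u(2) algebra_simps)
      then have rest: "norm (of_real R - of_real a * l) \<le> N"
        using N[of n] by (simp only: norm_mult norm_minus_cancel u mult_1_right)
      \<comment> \<open>Shortening the coordinate \<open>n\<close> needs \<open>l\<close> on one side of the origin and shortening the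
        others needs it on the opposite side: the two bounds add up to \<open>R + a < R + a\<close>.\<close>
      have "of_real (R + a) = (of_real R - of_real a * l) + of_real a * (1 + l)"
        by (simp add: algebra_simps)
      then have "norm (of_real (R + a) :: 'k)
          \<le> norm (of_real R - of_real a * l) + norm (of_real a * (1 + l))"
        by (metis norm_triangle_ineq)
      then have "R + a \<le> norm (of_real R - of_real a * l) + a * norm (1 + l)"
        using aR a0 by (simp add: norm_mult del: of_real_add)
      also have "\<dots> \<le> N + a * 1"
        using rest l1 a0 by (intro add_mono mult_left_mono) auto
      finally show False
        using less by simp
    qed
    then show "norm (y k) \<le> sup_norm (\<lambda>k. y k + l * x k)"
      using yR[of k] unfolding N_def by linarith
  qed
  then have "bj_orth x y"
    using rs y by (auto simp: right_symmetric_def)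
  moreover have "\<not> bj_orth x y"
  proof (rule not_bj_orthI)
    \<comment> \<open>This step length makes the new bounds \<open>a + t * R\<close> and \<open>(1 - t) * R\<close> equal.\<close>
    define t where "t = (R - a) / (2 * R)"
    have t: "0 \<le> t" "t \<le> 1" "a + t * R = (R + a) / 2" "(1 - t) * R = (R + a) / 2"
      using aR a0 by (auto simp: t_def field_simps)
    show "norm (x k + (- of_real t) * y k) \<le> (R + a) / 2" for k
    proof (cases "k = n")
      case True
      then have "x k + (- of_real t) * y k = of_real (a + t * R) * u"
        by (simp add: y_def u(2) algebra_simps)
      then show ?thesis
        using t(3) u(1) a0 aR by (simp add: norm_mult del: of_real_add of_real_mult of_real_divide)
    next
      case False
      then have "x k + (- of_real t) * y k = of_real (1 - t) * x k"
        by (simp add: y_def algebra_simps)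
      then have "norm (x k + (- of_real t) * y k) = (1 - t) * norm (x k)"
        using t(2) by (simp add: norm_mult del: of_real_diff)
      also have "\<dots> \<le> (1 - t) * R"
        using t(2) R by (intro mult_left_mono) auto
      finally show ?thesis
        using t(4) by simp
    qed
    show "(R + a) / 2 < sup_norm x"
      using aR by (simp add: R_def)
  qed
  ultimately show False
    by blast
qed

lemma right_symmetric_null_eq_0:
  assumes "sequence_space X" "X \<subseteq> null_seqs" "right_symmetric X x"
  shows "x = (\<lambda>n. 0)"
proof -
  have eq: "norm (x n) = sup_norm x" for n
    by (rule sequence_space.right_symmetric_norm_eq[OF assms(1,3)])
  have "x \<longlonglongrightarrow> 0"
    using assms by (auto simp: right_symmetric_def null_seqs_def)
  then have "(\<lambda>n. norm (x n)) \<longlonglongrightarrow> 0"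
    by (rule tendsto_norm_zero)
  then have "sup_norm x = 0"
    unfolding eq by (simp add: LIMSEQ_const_iff)
  then show ?thesis
    using eq by (auto simp: fun_eq_iff)
qed

text \<open>
  Since \<open>z\<close> lies within \<open>r\<close> of \<open>-1\<close>, its component along \<open>1\<close> in the real inner product is at most
  \<open>-\<mu>\<close>. Hence shifting \<open>z\<close> by \<open>\<mu>\<close> lowers its squared modulus by an amount that depends only on \<open>r\<close>,
  which makes the estimate uniform over all coordinates of a sequence.
\<close>

lemma norm_add_of_real_le:
  fixes z :: "'k::{real_normed_field,real_inner}"
  assumes "norm (1 + z) \<le> r" "r \<le> 1"
  defines "\<mu> \<equiv> (1 - r\<^sup>2) / 2"
  shows "(norm (z + of_real \<mu>))\<^sup>2 \<le> (norm z)\<^sup>2 - \<mu>\<^sup>2"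
proof -
  have "0 \<le> r"
    using assms(1) norm_ge_zero order_trans by blast
  then have \<mu>0: "0 \<le> \<mu>"
    using assms(2) by (simp add: \<mu>_def power_le_one)
  have "(norm (z + 1))\<^sup>2 \<le> r\<^sup>2"
    using assms(1) by (intro power_mono) (auto simp: add.commute)
  then have "2 * inner z 1 \<le> - 2 * \<mu> - (norm z)\<^sup>2"
    unfolding dot_norm \<mu>_def by (simp add: field_simps)
  then have "inner z 1 \<le> - \<mu>"
    using zero_le_power2[of "norm z"] by linarith
  then have "\<mu> * inner z 1 \<le> \<mu> * - \<mu>"
    using \<mu>0 by (rule mult_left_mono)
  moreover have "inner z (of_real \<mu>) = \<mu> * inner z 1"
    by (simp add: of_real_def)
  ultimately show ?thesis
    using dot_norm[of z "of_real \<mu>"] by (simp add: power2_eq_square)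
qed

text \<open>
  Contrapositive: if \<open>x + l y\<close> is shorter than \<open>x\<close>, then the quotients \<open>z n = l * y n / x n\<close> satisfy
  \<open>norm (1 + z n) \<le> r\<close> with one \<open>r < 1\<close> for all \<open>n\<close>, and a common shift shortens all of them.
\<close>

lemma bj_orth_constant_modulus:
  fixes x y :: "nat \<Rightarrow> 'k::{real_normed_field,real_inner}"
  assumes "Bseq x" "Bseq y" and mod: "\<And>n. norm (x n) = sup_norm x" and "bj_orth y x"
  shows "bj_orth x y"
proof (rule ccontr)
  define R where "R = sup_norm x"
  assume "\<not> bj_orth x y"
  then obtain l where l: "sup_norm (\<lambda>n. x n + l * y n) < R"
    by (auto simp: bj_orth_def R_def not_le)
  define r where "r = sup_norm (\<lambda>n. x n + l * y n) / R"
  have b: "norm (x n + l * y n) \<le> sup_norm (\<lambda>n. x n + l * y n)" for n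
    by (rule norm_le_sup_norm[OF Bseq_add_scaled[OF assms(1,2)]])
  have s0: "0 \<le> sup_norm (\<lambda>n. x n + l * y n)"
    using b[of 0] norm_ge_zero order_trans by blast
  then have R0: "0 < R"
    using l by simp
  have r: "0 \<le> r" "r < 1"
    using l s0 R0 by (auto simp: r_def)
  have l0: "l \<noteq> 0"
    using l by (auto simp: R_def)
  have xn: "norm (x n) = R" "x n \<noteq> 0" for n
    using mod[of n] R0 by (auto simp: R_def)
  define \<mu> where "\<mu> = (1 - r\<^sup>2) / 2"
  have \<mu>0: "0 < \<mu>"
    using r by (simp add: \<mu>_def power_less_one_iff abs_square_less_1)
  define \<delta> where "\<delta> = R / norm l * \<mu>"
  have \<delta>0: "0 < \<delta>"
    using R0 \<mu>0 l0 by (simp add: \<delta>_def)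
  define Y where "Y = sup_norm y"
  have Y: "norm (y n) \<le> Y" for n
    unfolding Y_def by (rule norm_le_sup_norm[OF assms(2)])
  have sq: "(norm (y n + of_real \<mu> / l * x n))\<^sup>2 \<le> Y\<^sup>2 - \<delta>\<^sup>2" for n
  proof -
    define z where "z = l * y n / x n"
    have "norm (1 + z) = norm ((x n + l * y n) / x n)"
      using xn(2)[of n] by (simp add: z_def field_simps)
    also have "\<dots> \<le> r"
      unfolding norm_divide xn(1) r_def by (rule divide_right_mono[OF b]) (use R0 in simp)
    finally have z: "(norm (z + of_real \<mu>))\<^sup>2 \<le> (norm z)\<^sup>2 - \<mu>\<^sup>2"
      unfolding \<mu>_def using r by (intro norm_add_of_real_le) auto
    have yz: "norm (y n) = R / norm l * norm z"
      using l0 R0 by (simp add: z_def norm_mult norm_divide xn(1))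
    have "y n + of_real \<mu> / l * x n = x n / l * (z + of_real \<mu>)"
      using xn(2)[of n] l0 by (simp add: z_def field_simps)
    then have "norm (y n + of_real \<mu> / l * x n) = R / norm l * norm (z + of_real \<mu>)"
      by (simp add: norm_mult norm_divide xn(1))
    then have "(norm (y n + of_real \<mu> / l * x n))\<^sup>2 \<le> (R / norm l)\<^sup>2 * ((norm z)\<^sup>2 - \<mu>\<^sup>2)"
      by (simp only: power_mult_distrib) (rule mult_left_mono[OF z], simp)
    also have "\<dots> = (norm (y n))\<^sup>2 - \<delta>\<^sup>2"
      unfolding yz \<delta>_def power_mult_distrib by (simp add: right_diff_distrib)
    also have "\<dots> \<le> Y\<^sup>2 - \<delta>\<^sup>2"
      by (intro diff_right_mono power_mono Y) simp
    finally show ?thesis .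
  qed
  have "\<not> bj_orth y x"
  proof (rule not_bj_orthI)
    show "norm (y n + of_real \<mu> / l * x n) \<le> sqrt (Y\<^sup>2 - \<delta>\<^sup>2)" for n
      by (rule real_le_rsqrt[OF sq])
    have "0 \<le> Y"
      using Y[of 0] norm_ge_zero order_trans by blast
    then show "sqrt (Y\<^sup>2 - \<delta>\<^sup>2) < sup_norm y"
      unfolding Y_def[symmetric] using \<delta>0 by (intro real_less_lsqrt) auto
  qed
  then show False
    using assms(4) by blast
qed

lemma right_symmetric_conv_seqs_iff:
  fixes x :: "nat \<Rightarrow> 'k::{real_normed_field,real_inner}"
  shows "right_symmetric conv_seqs x \<longleftrightarrow> x \<in> conv_seqs \<and> (\<forall>n. norm (x n) = sup_norm x)"
  using sequence_space.right_symmetric_norm_eq[OF sequence_space_conv_seqs, of x]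
    bj_orth_constant_modulus[OF Bseq_conv_seqs Bseq_conv_seqs]
  by (auto simp: right_symmetric_def)

section \<open>Isometries\<close>

lemma sup_norm_signed_permutation:
  assumes "signed_permutation S"
  shows "sup_norm (S x) = sup_norm x"
proof -
  obtain \<sigma> c where \<sigma>: "bij \<sigma>" and c: "\<forall>n. norm (c n) = 1" and S: "S x = (\<lambda>n. c n * x (\<sigma> n))"
    using assms unfolding signed_permutation_def by metis
  have "range (\<lambda>n. norm (S x n)) = (\<lambda>n. norm (x n)) ` range \<sigma>"
    by (auto simp: S norm_mult c)
  then show ?thesis
    using bij_is_surj[OF \<sigma>] by (simp add: sup_norm_def)
qed

context sequence_space
begin

lemma linear_isometry_onto_signed_permutation:
  assumes "signed_permutation S" "S ` X = X" "\<And>x. x \<in> X \<Longrightarrow> T x = S x"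
  shows "linear_isometry_onto X T"
proof -
  obtain \<sigma> c where S: "\<And>x. S x = (\<lambda>n. c n * x (\<sigma> n))"
    using assms(1) unfolding signed_permutation_def by metis
  have "T ` X = X"
    using assms(2) assms(3) image_cong[of X X T S] by simp
  then show ?thesis
    unfolding linear_isometry_onto_def
    by (simp add: assms(3) add_closed scale_closed sup_norm_signed_permutation[OF assms(1)])
      (simp add: S algebra_simps)
qed

lemma isometry_add_scaled:
  assumes "linear_isometry_onto X T" "x \<in> X" "y \<in> X"
  shows "T (\<lambda>n. x n + l * y n) = (\<lambda>n. T x n + l * T y n)"
  using assms scale_closed[of y l] by (simp add: linear_isometry_onto_def)

lemma isometry_bj_orth_iff:
  assumes T: "linear_isometry_onto X T" and "x \<in> X" "y \<in> X"
  shows "bj_orth (T x) (T y) \<longleftrightarrow> bj_orth x y"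
  using assms add_scaled_closed[OF assms(2,3)]
  unfolding bj_orth_def isometry_add_scaled[OF assms, symmetric]
  by (simp add: linear_isometry_onto_def)

lemma isometry_left_symmetric_iff:
  assumes T: "linear_isometry_onto X T" and x: "x \<in> X"
  shows "left_symmetric X (T x) \<longleftrightarrow> left_symmetric X x"
proof -
  have im: "T ` X = X"
    using T by (simp add: linear_isometry_onto_def)
  have "left_symmetric X (T x) \<longleftrightarrow> (\<forall>y\<in>T ` X. bj_orth (T x) y \<longrightarrow> bj_orth y (T x))"
    using im x by (auto simp: left_symmetric_def)
  also have "\<dots> \<longleftrightarrow> left_symmetric X x"
    using isometry_bj_orth_iff[OF T] x by (simp add: left_symmetric_def)
  finally show ?thesis .
qed

lemma isometry_is_signed_permutation:
  assumes T: "linear_isometry_onto X T"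
  shows "\<exists>S. signed_permutation S \<and> S ` X = X \<and> (\<forall>x\<in>X. T x = S x)"
proof -
  have im: "T ` X = X"
    and scale: "\<And>a x. x \<in> X \<Longrightarrow> T (\<lambda>n. a * x n) = (\<lambda>n. a * T x n)"
    and isom: "\<And>x. x \<in> X \<Longrightarrow> sup_norm (T x) = sup_norm x"
    using T by (auto simp: linear_isometry_onto_def)
  have TX: "T x \<in> X" if "x \<in> X" for x
    using im that by blast
  have "left_symmetric X (unit_seq n)" for n
    using left_symmetric_scaled_unit_seq[of 1 n] by simp
  then have "\<exists>a m. T (unit_seq n) = (\<lambda>k. a * unit_seq m k)" for n
    using isometry_left_symmetric_iff[OF T unit_seq_closed] left_symmetric_iff by blast
  then obtain c s where cs: "\<And>n. T (unit_seq n) = (\<lambda>k. c n * unit_seq (s n) k)"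
    by metis
  have c: "norm (c n) = 1" for n
    using isom[OF unit_seq_closed, of n] sup_norm_scaled_unit_seq[of 1 n]
    by (simp add: cs sup_norm_scaled_unit_seq)
  then have c0: "c n \<noteq> 0" for n
    by (metis norm_zero zero_neq_one)
  have vanish: "T y (s n) = 0" if y: "y \<in> X" "y n = 0" for y n
  proof -
    have "bj_orth (T (unit_seq n)) (T y)"
      using isometry_bj_orth_iff[OF T unit_seq_closed y(1)] bj_orth_unit_seq[OF bounded[OF y(1)]] y
      by blast
    then show ?thesis
      unfolding cs using bj_orth_unit_seq_iff[OF bounded[OF TX[OF y(1)]] c0] by blast
  qed
  have coordinate: "T x (s n) = c n * x n" if x: "x \<in> X" for x n
  proof -
    define y where "y = (\<lambda>k. x k + (- x n) * unit_seq n k)"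
    have "y \<in> X" "y n = 0"
      unfolding y_def by (rule add_scaled_closed[OF x unit_seq_closed]) (simp add: unit_seq_def)
    then have "T y (s n) = 0"
      by (rule vanish)
    then show ?thesis
      unfolding y_def isometry_add_scaled[OF T x unit_seq_closed] cs
      by (simp add: unit_seq_def)
  qed
  have "inj s"
  proof (rule injI, rule ccontr)
    fix n m assume "s n = s m" "n \<noteq> m"
    then have "T (unit_seq m) (s m) = 0"
      using vanish[OF unit_seq_closed, of m n] by (simp add: unit_seq_def[of m])
    then show False
      using c0[of m] unfolding cs by (simp add: unit_seq_def)
  qed
  moreover have "m \<in> range s" for m
  proof -
    obtain z where z: "z \<in> X" "T z = unit_seq m"
      using im unit_seq_closed[of m] by (metis imageE)
    then have "left_symmetric X z"
      using isometry_left_symmetric_iff[OF T z(1)] left_symmetric_scaled_unit_seq[of 1 m] by simp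
    then obtain a n where "z = (\<lambda>k. a * unit_seq n k)"
      using left_symmetric_iff by blast
    then have "unit_seq m = (\<lambda>k. a * (c n * unit_seq (s n) k))"
      using z scale[OF unit_seq_closed] cs by simp
    from fun_cong[OF this, of m] have "m = s n"
      by (auto simp: unit_seq_def split: if_splits)
    then show ?thesis by blast
  qed
  ultimately have "bij s"
    by (auto simp: bij_def)
  define S where "S = (\<lambda>x n. c (inv s n) * x (inv s n))"
  have "signed_permutation S"
    unfolding signed_permutation_def S_def
    by (rule exI[of _ "inv s"], rule exI[of _ "\<lambda>n. c (inv s n)"])
      (simp add: c bij_imp_bij_inv[OF \<open>bij s\<close>])
  moreover have TS: "T x = S x" if "x \<in> X" for x
  proof
    fix m
    have "s (inv s m) = m"
      using \<open>bij s\<close> by (simp add: bij_is_surj surj_f_inv_f)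
    then show "T x m = S x m"
      using coordinate[OF that, of "inv s m"] by (simp add: S_def)
  qed
  moreover have "S ` X = X"
    using im TS image_cong[of X X T S] by simp
  ultimately show ?thesis
    by (intro exI[of _ S]) simp
qed

lemma linear_isometry_onto_iff:
  "linear_isometry_onto X T \<longleftrightarrow>
    (\<exists>S. signed_permutation S \<and> S ` X = X \<and> (\<forall>x\<in>X. T x = S x))"
  by (rule iffI[OF isometry_is_signed_permutation])
    (auto intro: linear_isometry_onto_signed_permutation)

end

section \<open>Symmetric points and isometries of the three spaces\<close>

text \<open>The scalar field is generic here, covering the reals and the complex numbers at once.\<close>

lemma symmetric_points_and_isometries:
  "(\<forall>X \<in> {conv_seqs, null_seqs, fin_seqs :: (nat \<Rightarrow> 'k::{real_normed_field,real_inner}) set}.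
        {x. left_symmetric X x} = {x. \<exists>(a::'k) n. x = (\<lambda>k. a * unit_seq n k)})
    \<and> {x. right_symmetric (conv_seqs :: (nat \<Rightarrow> 'k) set) x}
        = {x \<in> conv_seqs. \<forall>n. norm (x n) = sup_norm x}
    \<and> (\<forall>X \<in> {null_seqs, fin_seqs :: (nat \<Rightarrow> 'k) set}.
        \<not> (\<exists>x. x \<noteq> (\<lambda>n. 0) \<and> right_symmetric X x))
    \<and> (\<forall>X \<in> {conv_seqs, null_seqs, fin_seqs :: (nat \<Rightarrow> 'k) set}. \<forall>T.
        linear_isometry_onto X T \<longleftrightarrow>
        (\<exists>S. signed_permutation S \<and> S ` X = X \<and> (\<forall>x\<in>X. T x = S x)))"
proof -
  have space: "sequence_space X"
    if "X \<in> {conv_seqs, null_seqs, fin_seqs :: (nat \<Rightarrow> 'k) set}" for X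
    using that sequence_space_conv_seqs sequence_space_null_seqs sequence_space_fin_seqs by blast
  show ?thesis
  proof (intro conjI ballI allI)
    fix X :: "(nat \<Rightarrow> 'k) set" and T
    assume X: "X \<in> {conv_seqs, null_seqs, fin_seqs}"
    show "{x. left_symmetric X x} = {x. \<exists>a n. x = (\<lambda>k. a * unit_seq n k)}"
      using sequence_space.left_symmetric_iff[OF space[OF X]] by blast
    show "linear_isometry_onto X T \<longleftrightarrow>
        (\<exists>S. signed_permutation S \<and> S ` X = X \<and> (\<forall>x\<in>X. T x = S x))"
      by (rule sequence_space.linear_isometry_onto_iff[OF space[OF X]])
  next
    show "{x. right_symmetric (conv_seqs :: (nat \<Rightarrow> 'k) set) x}
        = {x \<in> conv_seqs. \<forall>n. norm (x n) = sup_norm x}"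
      by (simp add: right_symmetric_conv_seqs_iff)
  next
    fix X :: "(nat \<Rightarrow> 'k) set"
    assume "X \<in> {null_seqs, fin_seqs}"
    then show "\<not> (\<exists>x. x \<noteq> (\<lambda>n. 0) \<and> right_symmetric X x)"
      using right_symmetric_null_eq_0[OF space, of X] fin_seqs_subset_null_seqs by blast
  qed
qed

theorem theorem2p14:
  "((\<forall>X \<in> {conv_seqs, null_seqs, fin_seqs :: (nat \<Rightarrow> real) set}.
        {x. left_symmetric X x} = {x. \<exists>(a::real) n. x = (\<lambda>k. a * unit_seq n k)})
    \<and> {x. right_symmetric (conv_seqs :: (nat \<Rightarrow> real) set) x}
        = {x \<in> conv_seqs. \<forall>n. norm (x n) = sup_norm x}
    \<and> (\<forall>X \<in> {null_seqs, fin_seqs :: (nat \<Rightarrow> real) set}.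
        \<not> (\<exists>x. x \<noteq> (\<lambda>n. 0) \<and> right_symmetric X x))
    \<and> (\<forall>X \<in> {conv_seqs, null_seqs, fin_seqs :: (nat \<Rightarrow> real) set}. \<forall>T.
        linear_isometry_onto X T \<longleftrightarrow>
        (\<exists>S. signed_permutation S \<and> S ` X = X \<and> (\<forall>x\<in>X. T x = S x))))
   \<and>
   ((\<forall>X \<in> {conv_seqs, null_seqs, fin_seqs :: (nat \<Rightarrow> complex) set}.
        {x. left_symmetric X x} = {x. \<exists>(a::complex) n. x = (\<lambda>k. a * unit_seq n k)})
    \<and> {x. right_symmetric (conv_seqs :: (nat \<Rightarrow> complex) set) x}
        = {x \<in> conv_seqs. \<forall>n. norm (x n) = sup_norm x}
    \<and> (\<forall>X \<in> {null_seqs, fin_seqs :: (nat \<Rightarrow> complex) set}.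
        \<not> (\<exists>x. x \<noteq> (\<lambda>n. 0) \<and> right_symmetric X x))
    \<and> (\<forall>X \<in> {conv_seqs, null_seqs, fin_seqs :: (nat \<Rightarrow> complex) set}. \<forall>T.
        linear_isometry_onto X T \<longleftrightarrow>
        (\<exists>S. signed_permutation S \<and> S ` X = X \<and> (\<forall>x\<in>X. T x = S x))))"
  by (rule conjI[OF symmetric_points_and_isometries symmetric_points_and_isometries])

end
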